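(* Let $p\in(1,+\infty)$. For any $\varepsilon\in(0,1)$, there exists $r_\varepsilon>1$ with the following property: for any $\Lambda=(\lambda_n)_{n\in\mathbb N}$ such that $(p\lambda_n+1)_n$ is $r_\varepsilon$-lacunary, we have $$\forall a\in\ell^p(\omega),\qquad(1-\varepsilon)\|a\|_{\ell^p(\omega)}\le\|J_\Lambda(a)\|_p\le(1+\varepsilon)\|a\|_{\ell^p(\omega)},$$ where $\omega_n=(p\lambda_n+1)^{-1}$ and $J_\Lambda(a)=\sum_na_nt^{\lambda_n}$.
   Context: $\Lambda=(\lambda_n)_{n\in\mathbb N}$ denotes an increasing sequence of non-negative real numbers with $\sum_{n\ge1}1/\lambda_n<\infty$ and $\inf_n(\lambda_{n+1}-\lambda_n)>0$. A sequence $(u_n)_n$ of positive numbers is $r$-lacunary ($r>1$) if $u_{n+1}\ge ru_n$ for every $n$. $\|\cdot\|_p$ is the norm of $L^p([0,1],m)$, $m$ the Lebesgue measure. $\ell^p(\omega)$ is the space of complex sequences with norm $\|a\|_{\ell^p(\omega)}=(\sum_n|a_n|^p\omega_n)^{1/p}$. $J_\Lambda:\ell^p(\omega)\to M_\Lambda^p$ is $J_\Lambda(a)=\sum_na_nt^{\lambda_n}$, where $M_\Lambda^p$ is the closed linear span of the $t^{\lambda_n}$ in $L^p([0,1],m)$. *)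

theory Defs
  imports "HOL-Analysis.Analysis"
begin

text \<open>Elements of \<open>L\<^sup>p([0,1])\<close> are represented by functions rather than by classes modulo
  a.e. equality; only their restriction to \<open>[0,1]\<close> matters.\<close>

definition Lp_space :: "real \<Rightarrow> (real \<Rightarrow> complex) set" where
  "Lp_space p = {f. f \<in> borel_measurable (lebesgue_on {0..1}) \<and>
                    integrable (lebesgue_on {0..1}) (\<lambda>t. norm (f t) powr p)}"

text \<open>The value is meaningful only for members of \<open>Lp_space p\<close>: the Bochner integral of a
  non-integrable function is 0.\<close>

definition Lp_norm :: "real \<Rightarrow> (real \<Rightarrow> complex) \<Rightarrow> real" where
  "Lp_norm p f = (\<integral>t. norm (f t) powr p \<partial>lebesgue_on {0..1}) powr (1 / p)"

definition weighted_lp :: "real \<Rightarrow> (nat \<Rightarrow> real) \<Rightarrow> (nat \<Rightarrow> complex) set" where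
  "weighted_lp p \<omega> = {a. summable (\<lambda>n. norm (a n) powr p * \<omega> n)}"

definition weighted_lp_norm :: "real \<Rightarrow> (nat \<Rightarrow> real) \<Rightarrow> (nat \<Rightarrow> complex) \<Rightarrow> real" where
  "weighted_lp_norm p \<omega> a = (\<Sum>n. norm (a n) powr p * \<omega> n) powr (1 / p)"

text \<open>Indices start at 0, so the first exponent may be 0; the sum of reciprocals starts at
  index 1.\<close>

definition muntz_sequence :: "(nat \<Rightarrow> real) \<Rightarrow> bool" where
  "muntz_sequence \<Lambda> \<longleftrightarrow> strict_mono \<Lambda> \<and> (\<forall>n. \<Lambda> n \<ge> 0) \<and> summable (\<lambda>n. 1 / \<Lambda> (Suc n)) \<and>
     (INF n. \<Lambda> (Suc n) - \<Lambda> n) > 0"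

definition lacunary :: "real \<Rightarrow> (nat \<Rightarrow> real) \<Rightarrow> bool" where
  "lacunary r u \<longleftrightarrow> (\<forall>n. u n > 0) \<and> (\<forall>n. u (Suc n) \<ge> r * u n)"

text \<open>The case distinction is needed because \<open>0 powr 0 = 0\<close>.\<close>

definition monomial :: "real \<Rightarrow> real \<Rightarrow> complex" where
  "monomial l t = (if l = 0 then 1 else complex_of_real (t powr l))"

definition muntz_polynomials :: "(nat \<Rightarrow> real) \<Rightarrow> (real \<Rightarrow> complex) set" where
  "muntz_polynomials \<Lambda> = {\<lambda>t. \<Sum>n<N. c n * monomial (\<Lambda> n) t | (c :: nat \<Rightarrow> complex) N. True}"

definition muntz_space :: "real \<Rightarrow> (nat \<Rightarrow> real) \<Rightarrow> (real \<Rightarrow> complex) set" where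
  "muntz_space p \<Lambda> = {f \<in> Lp_space p. \<forall>e>0. \<exists>g\<in>muntz_polynomials \<Lambda>. Lp_norm p (\<lambda>t. f t - g t) < e}"

text \<open>Taken pointwise: for \<open>a\<close> in \<open>weighted_lp p \<omega>\<close> with \<open>\<omega> n = 1 / (p * \<Lambda> n + 1)\<close> the
  coefficients grow at most polynomially in \<open>\<Lambda> n\<close>, so the series converges absolutely
  on \<open>[0,1)\<close>. At \<open>t = 1\<close> it may diverge, and \<open>suminf\<close> is then unspecified, on a null set.\<close>

definition J :: "(nat \<Rightarrow> real) \<Rightarrow> (nat \<Rightarrow> complex) \<Rightarrow> real \<Rightarrow> complex" where
  "J \<Lambda> a t = (\<Sum>n. a n * monomial (\<Lambda> n) t)"

text \<open>What the typing \<open>J\<^sub>\<Lambda> : \<ell>\<^sup>p(\<omega>) \<rightarrow> M\<^sub>\<Lambda>\<^sup>p\<close> asserts about \<open>a\<close>: the pointwise sum lies in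
  \<open>M\<^sub>\<Lambda>\<^sup>p\<close> and is also the sum of the series in \<open>L\<^sup>p\<close>. Membership makes
  \<open>Lp_norm p (J \<Lambda> a)\<close> meaningful.\<close>

definition J_well_defined :: "real \<Rightarrow> (nat \<Rightarrow> real) \<Rightarrow> (nat \<Rightarrow> complex) \<Rightarrow> bool" where
  "J_well_defined p \<Lambda> a \<longleftrightarrow> J \<Lambda> a \<in> muntz_space p \<Lambda> \<and>
     (\<lambda>N. Lp_norm p (\<lambda>t. J \<Lambda> a t - (\<Sum>n<N. a n * monomial (\<Lambda> n) t))) \<longlonglongrightarrow> 0"

definition muntz_weight :: "real \<Rightarrow> (nat \<Rightarrow> real) \<Rightarrow> nat \<Rightarrow> real" where
  "muntz_weight p \<Lambda> n = inverse (p * \<Lambda> n + 1)"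

end

theory Submission
  imports Defs
begin

text \<open>
  Normalised in \<open>L\<^sup>p\<close>, the function \<open>t powr \<lambda>\<^sub>n\<close> has almost all its mass on the interval
  around \<open>exp (- 1 / u\<^sub>n)\<close>, where \<open>u\<^sub>n = p \<lambda>\<^sub>n + 1\<close>, with end points \<open>exp (- 1 / sqrt (u\<^sub>n\<^sub>-\<^sub>1 u\<^sub>n))\<close>
  and \<open>exp (- 1 / sqrt (u\<^sub>n u\<^sub>n\<^sub>+\<^sub>1))\<close>. These intervals partition \<open>(0,1)\<close>, and lacunarity bounds the
  \<open>L\<^sup>p\<close>-norm of the \<open>n\<close>-th normalised function on the \<open>m\<close>-th interval by \<open>q\<^bsup>2|m-n|-1\<^esup>\<close> with
  \<open>q = r powr (- 1 / (2 p))\<close>. By Jensen's inequality with these numbers as weights, the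
  off-diagonal part of \<open>J\<close> is an operator of norm at most \<open>C = 2 q / (1 - q\<^sup>2)\<close>, while the
  diagonal part is almost isometric; both errors vanish as \<open>r \<rightarrow> \<infinity>\<close>.
\<close>

section \<open>Jensen's inequality with unnormalised weights\<close>

text \<open>Convexity of \<open>powr p\<close> is applied to the ratios \<open>y i / w i\<close>
  with the weights \<open>w i / S\<close>, where \<open>S\<close> is the total weight of the indices
  with \<open>0 < y i\<close>. Restricting to these indices keeps every denominator
  positive.\<close>

lemma powr_sum_le_weighted:
  fixes w y :: "'i \<Rightarrow> real"
  assumes "1 \<le> p" "finite I" "\<And>i. i \<in> I \<Longrightarrow> 0 \<le> w i" "\<And>i. i \<in> I \<Longrightarrow> 0 \<le> y i"
    and "\<And>i. i \<in> I \<Longrightarrow> w i = 0 \<Longrightarrow> y i = 0" and "sum w I \<le> W"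
  shows "(\<Sum>i\<in>I. y i) powr p \<le> W powr (p - 1) * (\<Sum>i\<in>I. w i powr (1 - p) * y i powr p)"
proof -
  define K where "K = {i \<in> I. 0 < y i}"
  have K: "finite K" "K \<subseteq> I" "\<And>i. i \<in> K \<Longrightarrow> 0 < y i" "\<And>i. i \<in> K \<Longrightarrow> 0 < w i"
    using assms by (auto simp: K_def order.strict_iff_order)
  have y0: "y i = 0" if "i \<in> I - K" for i
    using that assms(4)[of i] by (auto simp: K_def)
  have sy: "sum y I = sum y K"
    by (rule sum.mono_neutral_right) (use assms K y0 in auto)
  show ?thesis
  proof (cases "K = {}")
    case True
    then show ?thesis
      using sy by (simp add: sum_nonneg)
  next
    case False
    \<comment> \<open>Jensen's inequality needs weights of total exactly 1, whereas \<open>W\<close>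
      is only an upper bound; it replaces \<open>S\<close> at the end, where the exponent
      \<open>p - 1\<close> is nonnegative.\<close>
    define S where "S = sum w K"
    have S: "0 < S" "S \<le> W"
      using False K assms sum_mono2[of I K w] by (auto simp: S_def intro!: sum_pos)
    have "(\<Sum>i\<in>K. (w i / S) *\<^sub>R (y i / w i)) powr p \<le> (\<Sum>i\<in>K. w i / S * (y i / w i) powr p)"
      using K False S assms(1)
      by (intro convex_on_sum[OF _ _ powr_convex]) (auto simp: S_def simp flip: sum_divide_distrib intro: less_imp_le)
    moreover have "(\<Sum>i\<in>K. (w i / S) *\<^sub>R (y i / w i)) = sum y K / S"
      unfolding sum_divide_distrib using S K(4) by (intro sum.cong) force+
    moreover have "(\<Sum>i\<in>K. w i / S * (y i / w i) powr p) = (\<Sum>i\<in>K. w i powr (1 - p) * y i powr p) / S"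
      unfolding sum_divide_distrib
    proof (intro sum.cong refl)
      fix i assume "i \<in> K"
      then have "0 < w i" "0 < y i"
        using K by auto
      then show "w i / S * (y i / w i) powr p = w i powr (1 - p) * y i powr p / S"
        by (simp add: powr_divide powr_diff)
    qed
    moreover have "(sum y K / S) powr p = sum y K powr p / S powr p"
      using S K by (simp add: powr_divide sum_nonneg less_imp_le)
    ultimately have "sum y K powr p / S powr p \<le> (\<Sum>i\<in>K. w i powr (1 - p) * y i powr p) / S"
      by simp
    then have "sum y K powr p \<le> S powr (p - 1) * (\<Sum>i\<in>K. w i powr (1 - p) * y i powr p)"
      using S by (simp add: powr_diff pos_divide_le_eq mult.commute)
    also have "\<dots> \<le> W powr (p - 1) * (\<Sum>i\<in>I. w i powr (1 - p) * y i powr p)"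
      using S assms K by (intro mult_mono powr_mono2 sum_mono2 sum_nonneg) auto
    finally show ?thesis
      using sy by simp
  qed
qed

text \<open>The finite inequality holds for every partial sum, with a right-hand side bounded by the
  full series; then the partial sums converge. Working in \<open>ennreal\<close> lets the right-hand
  side be infinite.\<close>

lemma powr_norm_suminf_le_weighted:
  fixes x :: "nat \<Rightarrow> complex"
  assumes "1 \<le> p" "summable (\<lambda>n. norm (x n))" "\<And>n. 0 \<le> w n" "\<And>n. w n = 0 \<Longrightarrow> x n = 0"
    and W: "(\<Sum>n. ennreal (w n)) \<le> ennreal W" "0 \<le> W"
  shows "ennreal (norm (\<Sum>n. x n) powr p)
    \<le> ennreal (W powr (p - 1)) * (\<Sum>n. ennreal (w n powr (1 - p)) * ennreal (norm (x n) powr p))"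
proof (rule LIMSEQ_le_const2)
  have "(\<lambda>N. norm (\<Sum>n<N. x n)) \<longlonglongrightarrow> norm (\<Sum>n. x n)"
    by (intro tendsto_norm summable_LIMSEQ) (rule summable_norm_cancel[OF assms(2)])
  then show "(\<lambda>N. ennreal (norm (\<Sum>n<N. x n) powr p)) \<longlonglongrightarrow> ennreal (norm (\<Sum>n. x n) powr p)"
    using assms(1) by (intro tendsto_ennrealI tendsto_powr'[OF _ tendsto_const]) auto
  have "ennreal (norm (\<Sum>n<N. x n) powr p) \<le>
    ennreal (W powr (p - 1)) * (\<Sum>n. ennreal (w n powr (1 - p)) * ennreal (norm (x n) powr p))" for N
  proof -
    have "(\<Sum>n<N. ennreal (w n)) \<le> (\<Sum>n. ennreal (w n))"
      by (intro sum_le_suminf) auto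
    then have "(\<Sum>n<N. ennreal (w n)) \<le> ennreal W"
      using W(1) by (rule order_trans)
    then have "(\<Sum>n<N. w n) \<le> W"
      using assms(3) W(2) by simp
    then have "(\<Sum>n<N. norm (x n)) powr p
        \<le> W powr (p - 1) * (\<Sum>n<N. w n powr (1 - p) * norm (x n) powr p)"
      using assms by (intro powr_sum_le_weighted) auto
    moreover have "norm (\<Sum>n<N. x n) powr p \<le> (\<Sum>n<N. norm (x n)) powr p"
      using assms by (intro powr_mono2 norm_sum) auto
    ultimately have "ennreal (norm (\<Sum>n<N. x n) powr p)
        \<le> ennreal (W powr (p - 1) * (\<Sum>n<N. w n powr (1 - p) * norm (x n) powr p))"
      by (intro ennreal_leI) linarith
    also have "\<dots> = ennreal (W powr (p - 1)) *
        (\<Sum>n<N. ennreal (w n powr (1 - p)) * ennreal (norm (x n) powr p))"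
      by (simp add: ennreal_mult' sum_nonneg flip: sum_ennreal)
    also have "\<dots> \<le> ennreal (W powr (p - 1)) *
        (\<Sum>n. ennreal (w n powr (1 - p)) * ennreal (norm (x n) powr p))"
      by (intro mult_left_mono sum_le_suminf) auto
    finally show ?thesis .
  qed
  then show "\<exists>N. \<forall>n\<ge>N. ennreal (norm (\<Sum>n<n. x n) powr p) \<le> ennreal (W powr (p - 1)) * (\<Sum>n. ennreal (w n powr (1 - p)) * ennreal (norm (x n) powr p))"
    by blast
qed

section \<open>A Schur test over countably many pieces\<close>

text \<open>Tonelli's theorem for two counting measures.\<close>

lemma suminf_ennreal_swap:
  fixes f :: "nat \<Rightarrow> nat \<Rightarrow> ennreal"
  shows "(\<Sum>m. \<Sum>n. f m n) = (\<Sum>n. \<Sum>m. f m n)"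
  using nn_integral_suminf[of "\<lambda>n m. f m n" "count_space UNIV"]
  by (simp add: nn_integral_count_space_nat)

text \<open>A Schur test; the junk value \<open>0 powr (1 - p) = 0\<close> drops the entries of weight 0.\<close>

lemma block_powr_le:
  fixes x :: "nat \<Rightarrow> 'a \<Rightarrow> complex" and g :: "nat \<Rightarrow> 'a \<Rightarrow> complex" and w :: "nat \<Rightarrow> nat \<Rightarrow> real"
  assumes p: "1 \<le> p" and W: "0 < W"
    and x [measurable]: "\<And>n. x n \<in> borel_measurable M" and A [measurable]: "\<And>m. A m \<in> sets M"
    and w: "\<And>m n. 0 \<le> w m n"
    and col: "\<And>n. (\<Sum>m. ennreal (w m n)) \<le> ennreal W"
    and g: "\<And>m t. t \<in> A m \<Longrightarrow> ennreal (norm (g m t) powr p) \<le> ennreal (W powr (p - 1)) *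
      (\<Sum>n. ennreal (w m n powr (1 - p)) * ennreal (norm (x n t) powr p))"
    and B: "\<And>m n. w m n \<noteq> 0 \<Longrightarrow> (\<integral>\<^sup>+t\<in>A m. ennreal (norm (x n t) powr p) \<partial>M) \<le> ennreal (w m n powr p) * B n"
  shows "(\<Sum>m. \<integral>\<^sup>+t\<in>A m. ennreal (norm (g m t) powr p) \<partial>M) \<le> ennreal (W powr p) * (\<Sum>n. B n)"
proof -
  define c where "c = ennreal (W powr (p - 1))"
  have "(\<integral>\<^sup>+t\<in>A m. ennreal (norm (g m t) powr p) \<partial>M) \<le> c * (\<Sum>n. ennreal (w m n) * B n)" for m
  proof -
    have "(\<integral>\<^sup>+t\<in>A m. ennreal (norm (g m t) powr p) \<partial>M) \<le>
      (\<integral>\<^sup>+t. c * (\<Sum>n. ennreal (w m n powr (1 - p)) * (ennreal (norm (x n t) powr p) * indicator (A m) t)) \<partial>M)"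
      using g[of _ m] by (intro nn_integral_mono) (auto simp: c_def indicator_def)
    also have "\<dots> = c * (\<Sum>n. ennreal (w m n powr (1 - p)) * (\<integral>\<^sup>+t\<in>A m. ennreal (norm (x n t) powr p) \<partial>M))"
      by (simp add: nn_integral_cmult nn_integral_suminf)
    also have "\<dots> \<le> c * (\<Sum>n. ennreal (w m n) * B n)"
    proof (intro mult_left_mono suminf_le summableI)
      fix n
      show "ennreal (w m n powr (1 - p)) * (\<integral>\<^sup>+t\<in>A m. ennreal (norm (x n t) powr p) \<partial>M) \<le> ennreal (w m n) * B n"
      proof (cases "w m n = 0")
        case False
        have "ennreal (w m n powr (1 - p)) * (\<integral>\<^sup>+t\<in>A m. ennreal (norm (x n t) powr p) \<partial>M)
          \<le> ennreal (w m n powr (1 - p)) * (ennreal (w m n powr p) * B n)"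
          using B[OF False] by (intro mult_left_mono) auto
        \<comment> \<open>The Jensen factor \<open>w m n powr (1 - p)\<close> cancels all but one
          power of the weight, so that the column sums can be used below.\<close>
        also have "\<dots> = ennreal (w m n) * B n"
          using w[of m n] False by (simp add: mult.assoc[symmetric] ennreal_mult[symmetric] powr_add[symmetric])
        finally show ?thesis .
      qed simp
    qed simp
    finally show ?thesis .
  qed
  then have "(\<Sum>m. \<integral>\<^sup>+t\<in>A m. ennreal (norm (g m t) powr p) \<partial>M) \<le> (\<Sum>m. c * (\<Sum>n. ennreal (w m n) * B n))"
    by (intro suminf_le summableI)
  \<comment> \<open>After the exchange the column bound supplies one more factor \<open>W\<close>,
    which completes \<open>W powr (p - 1)\<close> to \<open>W powr p\<close>.\<close>
  also have "\<dots> = c * (\<Sum>n. (\<Sum>m. ennreal (w m n)) * B n)"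
    by (simp add: suminf_ennreal_swap[of "\<lambda>m n. ennreal (w m n) * B n"])
  also have "\<dots> \<le> c * (\<Sum>n. ennreal W * B n)"
    by (intro mult_left_mono suminf_le summableI mult_right_mono col) auto
  also have "\<dots> = ennreal (W powr p) * (\<Sum>n. B n)"
    using W by (simp add: c_def mult.assoc[symmetric] ennreal_mult[symmetric] powr_diff)
  finally show ?thesis .
qed

section \<open>A kernel with geometric decay away from the diagonal\<close>

text \<open>The two off-diagonal branches express the distance of the indices without an absolute
  value, since subtraction of naturals truncates.\<close>

definition offset_weight :: "real \<Rightarrow> real \<Rightarrow> nat \<Rightarrow> nat \<Rightarrow> real" where
  "offset_weight d q m n = (if m = n then d else if m < n then q ^ (2 * (n - m) - 1) else q ^ (2 * (m - n) - 1))"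

lemma offset_weight_commute: "offset_weight d q m n = offset_weight d q n m"
  by (auto simp: offset_weight_def)

text \<open>The shift \<open>k = Suc j\<close> turns the terms into
  \<open>q * (q\<^sup>2) ^ j\<close>, part of a geometric series. The index 0 must be excluded: by
  truncation its exponent would be 0 instead of odd.\<close>

lemma sum_odd_powers_le:
  fixes q :: real
  assumes "0 \<le> q" "q < 1" "finite K" "0 \<notin> K"
  shows "(\<Sum>k\<in>K. q ^ (2 * k - 1)) \<le> q / (1 - q\<^sup>2)"
proof -
  have q2: "q\<^sup>2 < 1"
    using assms by (simp add: power_less_one_iff)
  have "(\<Sum>k\<in>K. q ^ (2 * k - 1)) = (\<Sum>j\<in>(\<lambda>k. k - 1) ` K. q * (q\<^sup>2) ^ j)"
  proof (subst sum.reindex)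
    show "inj_on (\<lambda>k. k - 1) K"
      using assms by (intro inj_onI) (metis Suc_pred' not_gr_zero)
    show "(\<Sum>k\<in>K. q ^ (2 * k - 1)) = sum ((\<lambda>j. q * (q\<^sup>2) ^ j) \<circ> (\<lambda>k. k - 1)) K"
    proof (intro sum.cong refl)
      fix k assume "k \<in> K"
      then obtain j where "k = Suc j"
        using assms by (metis not0_implies_Suc)
      then show "q ^ (2 * k - 1) = ((\<lambda>j. q * (q\<^sup>2) ^ j) \<circ> (\<lambda>k. k - 1)) k"
        by (simp add: power_mult)
    qed
  qed
  also have "\<dots> \<le> (\<Sum>j. q * (q\<^sup>2) ^ j)"
    using assms q2 by (intro sum_le_suminf summable_mult summable_geometric) auto
  also have "\<dots> = q / (1 - q\<^sup>2)"
    using q2 by (simp add: suminf_mult suminf_geometric summable_geometric)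
  finally show ?thesis .
qed

text \<open>On either side of the diagonal the distances to \<open>n\<close> are distinct positive
  integers, so each side costs at most one series of odd powers. It suffices to bound partial sums,
  uniformly in their length.\<close>

lemma suminf_offset_weight_le:
  assumes "0 < q" "q < 1" "0 \<le> d"
  shows "(\<Sum>m. ennreal (offset_weight d q m n)) \<le> ennreal (d + 2 * (q / (1 - q\<^sup>2)))"
proof (rule suminf_le_const)
  fix N
  have "(\<Sum>m<N. offset_weight d q m n) \<le> (\<Sum>m\<in>{n} \<union> ({..<n} \<union> {n<..<n + N}). offset_weight d q m n)"
    using assms by (intro sum_mono2) (auto simp: offset_weight_def)
  also have "\<dots> = d + ((\<Sum>m<n. offset_weight d q m n) + (\<Sum>m\<in>{n<..<n + N}. offset_weight d q m n))"
    by (subst sum.union_disjoint, simp, simp, force, subst sum.union_disjoint)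
      (auto simp: offset_weight_def)
  also have "(\<Sum>m<n. offset_weight d q m n) = (\<Sum>k\<in>(\<lambda>m. n - m) ` {..<n}. q ^ (2 * k - 1))"
    by (subst sum.reindex) (auto simp: offset_weight_def inj_on_def)
  also have "(\<Sum>m\<in>{n<..<n + N}. offset_weight d q m n) = (\<Sum>k\<in>(\<lambda>m. m - n) ` {n<..<n + N}. q ^ (2 * k - 1))"
    by (subst sum.reindex) (auto simp: offset_weight_def inj_on_def)
  also have "d + ((\<Sum>k\<in>(\<lambda>m. n - m) ` {..<n}. q ^ (2 * k - 1)) + (\<Sum>k\<in>(\<lambda>m. m - n) ` {n<..<n + N}. q ^ (2 * k - 1)))
    \<le> d + (q / (1 - q\<^sup>2) + q / (1 - q\<^sup>2))"
    using assms by (intro add_mono order_refl sum_odd_powers_le) auto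
  finally show "(\<Sum>m<N. ennreal (offset_weight d q m n)) \<le> ennreal (d + 2 * (q / (1 - q\<^sup>2)))"
    using assms by (subst sum_ennreal) (auto simp: offset_weight_def intro!: ennreal_leI)
qed auto

section \<open>Integrals of powers, and \<open>Lp_norm\<close> through nonnegative integrals\<close>

lemma nn_integral_powr_from_0:
  assumes "0 \<le> a" "0 \<le> (c::real)"
  shows "(\<integral>\<^sup>+t\<in>{0..c}. ennreal (t powr a) \<partial>lborel) = ennreal (c powr (a + 1) / (a + 1))"
  using assms by (intro nn_integral_has_integral_lebesgue' has_integral_powr_from_0) auto

lemma nn_integral_powr_to_1:
  assumes "0 \<le> a" "0 \<le> (c::real)" "c \<le> 1"
  shows "(\<integral>\<^sup>+t\<in>{c..1}. ennreal (t powr a) \<partial>lborel) = ennreal ((1 - c powr (a + 1)) / (a + 1))"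
proof (rule nn_integral_has_integral_lebesgue')
  have "((\<lambda>x. x powr a) has_integral (1 powr (a+1) / (a+1) - c powr (a+1) / (a+1))) {c..1}"
  proof -
    have *: "(\<lambda>x. x powr a) integrable_on {c..1}"
      using integrable_on_powr_from_0[of a 1] assms integrable_on_subinterval by (metis atLeastatMost_subset_iff
          dual_order.refl less_le_trans neg_less_0_iff_less zero_less_one zero_le_one)
    then have "integral {0..c} (\<lambda>x. x powr a) + integral {c..1} (\<lambda>x. x powr a) = integral {0..1} (\<lambda>x. x powr a)"
      using assms by (intro Henstock_Kurzweil_Integration.integral_combine integrable_on_powr_from_0) auto
    then show ?thesis
      using * integral_unique[OF has_integral_powr_from_0[of a c]] integral_unique[OF has_integral_powr_from_0[of a 1]] assms
      by (simp add: has_integral_iff)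
  qed
  then show "((\<lambda>x. x powr a) has_integral (1 - c powr (a + 1)) / (a + 1)) {c..1}"
    by (simp add: diff_divide_distrib)
qed auto

text \<open>The middle interval and the two tails cover \<open>{0..1}\<close>. The tails stand on
  the right as summands, which avoids subtraction in \<open>ennreal\<close>.\<close>

lemma nn_integral_powr_from_to:
  assumes "0 \<le> a" "0 \<le> (b::real)" "b \<le> c" "c \<le> 1"
  shows "ennreal (1 / (a + 1)) \<le> (\<integral>\<^sup>+t\<in>{b<..c}. ennreal (t powr a) \<partial>lborel) +
    (ennreal (b powr (a + 1) / (a + 1)) + ennreal ((1 - c powr (a + 1)) / (a + 1)))"
proof -
  have "ennreal (1 / (a + 1)) = (\<integral>\<^sup>+t\<in>{0..1}. ennreal (t powr a) \<partial>lborel)"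
    using assms by (subst nn_integral_powr_from_0) auto
  also have "\<dots> \<le> (\<integral>\<^sup>+t. ennreal (t powr a) * indicator {b<..c} t +
      (ennreal (t powr a) * indicator {0..b} t + ennreal (t powr a) * indicator {c..1} t) \<partial>lborel)"
    by (intro nn_integral_mono) (auto simp: indicator_def)
  also have "\<dots> = (\<integral>\<^sup>+t\<in>{b<..c}. ennreal (t powr a) \<partial>lborel) +
      ((\<integral>\<^sup>+t\<in>{0..b}. ennreal (t powr a) \<partial>lborel) + (\<integral>\<^sup>+t\<in>{c..1}. ennreal (t powr a) \<partial>lborel))"
    by (simp add: nn_integral_add)
  finally show ?thesis
    using assms by (simp add: nn_integral_powr_from_0 nn_integral_powr_to_1)
qed

lemma borel_measurable_monomial [measurable]: "monomial l \<in> borel_measurable borel"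
  unfolding monomial_def[abs_def] by measurable

lemma norm_monomial: "0 < t \<Longrightarrow> norm (monomial l t) = t powr l"
  by (simp add: monomial_def)

lemma norm_monomial_powr: "0 < t \<Longrightarrow> norm (c * monomial l t) powr p = norm c powr p * t powr (p * l)"
  by (simp add: norm_mult norm_monomial powr_mult powr_powr mult.commute)

text \<open>The two end points are null. Without them the interval is the union of the cells below,
  and \<open>norm (monomial l t)\<close> is a genuine power.\<close>

lemma nn_integral_lebesgue_on_01:
  fixes f :: "real \<Rightarrow> ennreal"
  assumes [measurable]: "f \<in> borel_measurable borel"
  shows "(\<integral>\<^sup>+t. f t \<partial>lebesgue_on {0..1}) = (\<integral>\<^sup>+t\<in>{0<..<1}. f t \<partial>lborel)"
proof -
  have "(\<integral>\<^sup>+t. f t \<partial>lebesgue_on {0..1}) = (\<integral>\<^sup>+t\<in>{0..1}. f t \<partial>lebesgue)"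
    by (intro nn_integral_restrict_space) auto
  also have "\<dots> = (\<integral>\<^sup>+t\<in>{0..1}. f t \<partial>lborel)"
    by (intro nn_integral_completion)
  also have "\<dots> = (\<integral>\<^sup>+t\<in>{0<..<1}. f t \<partial>lborel)"
    using AE_lborel_singleton[of "0::real"] AE_lborel_singleton[of "1::real"]
    by (intro nn_integral_cong_AE) (auto simp: indicator_def)
  finally show ?thesis .
qed

lemma borel_measurable_lebesgue_on:
  "f \<in> borel_measurable borel \<Longrightarrow> f \<in> borel_measurable (lebesgue_on (S :: real set))"
  by (intro measurable_restrict_space1 measurable_completion) simp

text \<open>No integrability is required: \<open>enn2real\<close> sends infinity to 0, which is also
  the Bochner integral of a non-integrable function.\<close>

lemma Lp_norm_eq_nn_integral:
  assumes [measurable]: "f \<in> borel_measurable borel"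
  shows "Lp_norm p f = enn2real (\<integral>\<^sup>+t\<in>{0<..<1}. ennreal (norm (f t) powr p) \<partial>lborel) powr (1 / p)"
proof -
  have "(\<lambda>t. norm (f t) powr p) \<in> borel_measurable (lebesgue_on {0..1})"
    by (rule borel_measurable_lebesgue_on) measurable
  then show ?thesis
    by (simp add: Lp_norm_def integral_eq_nn_integral nn_integral_lebesgue_on_01)
qed

lemma Lp_space_if_nn_integral_finite:
  assumes [measurable]: "f \<in> borel_measurable borel"
    and "(\<integral>\<^sup>+t\<in>{0<..<1}. ennreal (norm (f t) powr p) \<partial>lborel) < \<infinity>"
  shows "f \<in> Lp_space p"
proof -
  have "(\<lambda>t. norm (f t) powr p) \<in> borel_measurable (lebesgue_on {0..1})"
    by (rule borel_measurable_lebesgue_on) measurable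
  then show ?thesis
    using assms by (auto simp: Lp_space_def borel_measurable_lebesgue_on nn_integral_lebesgue_on_01
        intro!: integrableI_bounded)
qed

section \<open>Dependence of the constants on the lacunarity ratio\<close>

text \<open>The \<open>p\<close>-th root of \<open>1 / sqrt r\<close>, because integrals of
  \<open>p\<close>-th powers gain a factor \<open>1 / sqrt r\<close> for each half step of
  lacunarity.\<close>

definition decay_ratio :: "real \<Rightarrow> real \<Rightarrow> real" where
  "decay_ratio p r = r powr (- 1 / (2 * p))"

definition offdiag_bound :: "real \<Rightarrow> real \<Rightarrow> real" where
  "offdiag_bound p r = 2 * (decay_ratio p r / (1 - (decay_ratio p r)\<^sup>2))"

text \<open>As \<open>r\<close> grows, \<open>offdiag_bound p r\<close> tends to 0 and the
  right-hand side of the second inequality tends to 1, which exceeds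
  \<open>(1 - \<epsilon>) powr p\<close>. The two inequalities are what the upper and the lower norm
  estimate require.\<close>

lemma ex_lacunarity_constant:
  fixes p \<epsilon> :: real
  assumes "1 \<le> p" "0 < \<epsilon>" "\<epsilon> < 1"
  shows "\<exists>r>1. offdiag_bound p r \<le> \<epsilon> \<and>
    (1 - \<epsilon>) powr p \<le> (1 - 2 / sqrt r) * (1 + offdiag_bound p r) powr (1 - p) - offdiag_bound p r"
proof -
  have q: "(decay_ratio p \<longlongrightarrow> 0) at_top"
    unfolding decay_ratio_def[abs_def] using assms by (intro tendsto_neg_powr filterlim_ident) (auto simp: field_simps)
  have C: "(offdiag_bound p \<longlongrightarrow> 2 * (0 / (1 - 0\<^sup>2))) at_top"
    unfolding offdiag_bound_def[abs_def] by (intro tendsto_intros q) auto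
  have "filterlim (\<lambda>r::real. sqrt r) at_top at_top"
    by (rule sqrt_at_top)
  then have "((\<lambda>r::real. 2 / sqrt r) \<longlongrightarrow> 0) at_top"
    by (rule real_tendsto_divide_at_top[OF tendsto_const])
  then have "((\<lambda>r. (1 - 2 / sqrt r) * (1 + offdiag_bound p r) powr (1 - p) - offdiag_bound p r) \<longlongrightarrow>
      (1 - 0) * (1 + 2 * (0 / (1 - 0\<^sup>2))) powr (1 - p) - 2 * (0 / (1 - 0\<^sup>2))) at_top"
    by (intro tendsto_intros C) auto
  then have "\<forall>\<^sub>F r in at_top. (1 - \<epsilon>) powr p < (1 - 2 / sqrt r) * (1 + offdiag_bound p r) powr (1 - p) - offdiag_bound p r"
    by (rule order_tendstoD) (use assms powr_less_mono2[of p "1 - \<epsilon>" 1] in auto)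
  moreover have "\<forall>\<^sub>F r in at_top. offdiag_bound p r < \<epsilon>"
    using C by (rule order_tendstoD) (use assms in auto)
  ultimately have "\<forall>\<^sub>F r in at_top. r > 1 \<and> offdiag_bound p r \<le> \<epsilon> \<and>
      (1 - \<epsilon>) powr p \<le> (1 - 2 / sqrt r) * (1 + offdiag_bound p r) powr (1 - p) - offdiag_bound p r"
    using eventually_gt_at_top[of 1] by eventually_elim auto
  then show ?thesis
    using eventually_happens'[OF trivial_limit_at_top_linorder] by blast
qed

section \<open>Growth of the exponents and the partition of the unit interval\<close>

locale lacunary_exponents =
  fixes p r :: real and \<Lambda> :: "nat \<Rightarrow> real"
  assumes p: "1 \<le> p" and r: "1 < r" and \<Lambda>_nonneg: "\<And>n. 0 \<le> \<Lambda> n"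
    and lacunary: "\<And>n. r * (p * \<Lambda> n + 1) \<le> p * \<Lambda> (Suc n) + 1"
begin

definition u :: "nat \<Rightarrow> real" where "u n = p * \<Lambda> n + 1"

text \<open>Indexed so that \<open>cut m\<close> is the left end point of \<open>cell m\<close>; the
  value at 0 replaces the missing predecessor of \<open>u 0\<close>.\<close>

definition cut :: "nat \<Rightarrow> real" where
  "cut m = (case m of 0 \<Rightarrow> 0 | Suc k \<Rightarrow> exp (- 1 / sqrt (u k * u (Suc k))))"

definition cell :: "nat \<Rightarrow> real set" where "cell m = {cut m<..cut (Suc m)}"

abbreviation q :: real where "q \<equiv> decay_ratio p r"

abbreviation C :: real where "C \<equiv> offdiag_bound p r"

abbreviation wt :: "real \<Rightarrow> nat \<Rightarrow> nat \<Rightarrow> real" where "wt d \<equiv> offset_weight d q"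

lemma u_ge_1: "1 \<le> u n"
  using p \<Lambda>_nonneg[of n] by (simp add: u_def)

lemma u_pos: "0 < u n"
  using u_ge_1[of n] by simp

lemma u_growth: "r ^ k * u n \<le> u (n + k)"
proof (induction k)
  case (Suc k)
  then have "r * (r ^ k * u n) \<le> r * u (n + k)"
    using r by (intro mult_left_mono) auto
  also have "\<dots> \<le> u (n + Suc k)"
    using lacunary[of "n + k"] by (simp add: u_def)
  finally show ?case
    by simp
qed simp

lemma u_Suc_ge: "u n \<le> u (Suc n)"
proof -
  have "1 * u n \<le> r * u n"
    using r u_pos[of n] by (intro mult_right_mono) auto
  then show ?thesis
    using u_growth[of 1 n] by simp
qed

lemma q_bounds: "0 < q" "q < 1"
  using r p powr_less_mono[of "- 1 / (2 * p)" 0 r] by (auto simp: decay_ratio_def)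

lemma C_pos: "0 < C"
  using q_bounds by (simp add: offdiag_bound_def power_less_one_iff)

lemma q_power_powr: "(q ^ k) powr p = 1 / sqrt r ^ k"
proof -
  have "q powr p = 1 / sqrt r"
  proof -
    have "q powr p = r powr (- (1 / 2))"
      using p by (simp add: decay_ratio_def powr_powr)
    then show ?thesis
      using r by (simp only: powr_minus_divide powr_half_sqrt)
  qed
  then show ?thesis
    using q_bounds r by (simp add: powr_realpow[symmetric] powr_powr mult.commute powr_powr[symmetric, of q p]
        powr_divide)
qed

text \<open>The geometric mean lies \<open>k\<close> and a half lacunary steps above
  \<open>u n\<close>, and every half step is worth \<open>sqrt r\<close>.\<close>

lemma sqrt_u_ge: "u n * sqrt r ^ (2 * k + 1) \<le> sqrt (u (n + k) * u (n + Suc k))"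
proof (rule real_le_rsqrt)
  have "(u n * sqrt r ^ (2 * k + 1))\<^sup>2 = (r ^ k * u n) * (r ^ Suc k * u n)"
  proof -
    have "(sqrt r ^ (2 * k + 1))\<^sup>2 = ((sqrt r)\<^sup>2) ^ (2 * k + 1)"
      by (simp only: power_mult[symmetric] mult.commute)
    also have "\<dots> = r ^ k * r ^ Suc k"
      using r by (simp add: power_add[symmetric] mult_2)
    finally show ?thesis
      by (simp add: power_mult_distrib power2_eq_square)
  qed
  also have "\<dots> \<le> u (n + k) * u (n + Suc k)"
    using r u_pos[of n] u_pos[of "n + k"] by (intro mult_mono u_growth) (auto intro: less_imp_le)
  finally show "(u n * sqrt r ^ (2 * k + 1))\<^sup>2 \<le> u (n + k) * u (n + Suc k)" .
qed

text \<open>The same count of half steps, now upwards from the geometric mean: \<open>Suc k\<close>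
  steps from \<open>u m\<close> and \<open>k\<close> steps from \<open>u (Suc m)\<close>.\<close>

lemma sqrt_u_le: "sqrt (u m * u (Suc m)) * sqrt r ^ (2 * k + 1) \<le> u (m + Suc k)"
proof -
  have "sqrt (u m * u (Suc m)) * sqrt r ^ (2 * k + 1) = sqrt ((r ^ Suc k * u m) * (r ^ k * u (Suc m)))"
    by (simp add: real_sqrt_mult real_sqrt_power power_add mult_2_right mult_ac)
  also have "\<dots> \<le> sqrt (u (m + Suc k) * u (m + Suc k))"
    using r u_pos u_growth[of "Suc k" m] u_growth[of k "Suc m"]
    by (intro real_sqrt_le_mono mult_mono) (auto intro!: mult_nonneg_nonneg less_imp_le)
  finally show ?thesis
    using u_pos[of "m + Suc k"] by simp
qed

lemma cut_bounds: "0 \<le> cut m" "cut m < 1"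
  using u_pos by (auto simp: cut_def split: nat.splits)

lemma mono_cut: "mono cut"
proof (rule mono_iff_le_Suc[THEN iffD2], rule)
  fix n
  show "cut n \<le> cut (Suc n)"
  proof (cases n)
    case (Suc k)
    have "sqrt (u k * u (Suc k)) \<le> sqrt (u (Suc k) * u (Suc (Suc k)))"
      using u_pos[of k] u_pos[of "Suc k"] u_Suc_ge by (intro real_sqrt_le_mono mult_mono) auto
    then show ?thesis
      using u_pos[of k] u_pos[of "Suc k"] by (simp add: Suc cut_def frac_le)
  qed (simp add: cut_def)
qed

text \<open>The geometric means dominate \<open>sqrt r ^ k\<close>, so the exponents tend to 0.
  Hence the cells reach every point below 1.\<close>

lemma cut_tendsto_1: "cut \<longlonglongrightarrow> 1"
proof -
  have "filterlim (\<lambda>k. sqrt (u k * u (Suc k))) at_top sequentially"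
  proof (rule filterlim_at_top_mono)
    show "filterlim (\<lambda>k. sqrt r ^ k) at_top sequentially"
      using r by (intro filterlim_at_infinity_imp_filterlim_at_top filterlim_realpow_sequentially_gt1) auto
    show "\<forall>\<^sub>F k in sequentially. sqrt r ^ k \<le> sqrt (u k * u (Suc k))"
    proof (intro always_eventually allI)
      fix k
      have "1 * sqrt r ^ (2 * k + 1) \<le> u 0 * sqrt r ^ (2 * k + 1)"
        using u_ge_1[of 0] r by (intro mult_right_mono) auto
      moreover have "sqrt r ^ k \<le> sqrt r ^ (2 * k + 1)"
        using r by (intro power_increasing) auto
      ultimately show "sqrt r ^ k \<le> sqrt (u k * u (Suc k))"
        using sqrt_u_ge[of 0 k] by simp
    qed
  qed
  then have "(\<lambda>k. exp (- 1 / sqrt (u k * u (Suc k)))) \<longlonglongrightarrow> exp 0"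
    by (intro tendsto_exp real_tendsto_divide_at_top[OF tendsto_const])
  then have "(\<lambda>k. cut (Suc k)) \<longlonglongrightarrow> 1"
    by (simp add: cut_def)
  then show ?thesis
    by (simp add: filterlim_sequentially_Suc)
qed

lemma cell_measurable [measurable]: "cell m \<in> sets borel"
  by (simp add: cell_def)

lemma cell_subset: "cell m \<subseteq> {0<..<1}"
  using cut_bounds by (fastforce simp: cell_def intro: le_less_trans)

lemma disjoint_family_cell: "disjoint_family cell"
proof -
  have "cell m \<inter> cell n = {}" if "m < n" for m n
    using monoD[OF mono_cut, of "Suc m" n] that by (auto simp: cell_def)
  then show ?thesis
    unfolding disjoint_family_on_def by (metis Int_commute nat_neq_iff)
qed

lemma UN_cell: "(\<Union>m. cell m) = {0<..<1}"
proof (intro equalityI subsetI)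
  fix t :: real
  assume t: "t \<in> {0<..<1}"
  have "\<forall>\<^sub>F n in sequentially. t < cut n"
    using t by (intro order_tendstoD[OF cut_tendsto_1]) auto
  then obtain n where n: "t \<le> cut n"
    by (metis eventually_happens less_imp_le trivial_limit_sequentially)
  \<comment> \<open>The first cut not below \<open>t\<close> is the right end point of the cell of
    \<open>t\<close>; it has a predecessor because \<open>cut 0 = 0 < t\<close>.\<close>
  define N where "N = (LEAST n. t \<le> cut n)"
  have N: "t \<le> cut N"
    unfolding N_def by (rule LeastI) (rule n)
  have "N \<noteq> 0"
    using N t by (auto simp: cut_def split: nat.splits)
  then obtain m where m: "N = Suc m"
    using not0_implies_Suc by blast
  have "\<not> t \<le> cut m"
    using not_less_Least[of m "\<lambda>n. t \<le> cut n"] m by (simp add: N_def)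
  then show "t \<in> (\<Union>m. cell m)"
    using N m by (auto simp: cell_def not_le)
qed (use cell_subset in blast)

lemma suminf_nn_integral_cell:
  fixes f :: "real \<Rightarrow> ennreal"
  assumes [measurable]: "f \<in> borel_measurable borel"
  shows "(\<Sum>m. \<integral>\<^sup>+t\<in>cell m. f t \<partial>lborel) = (\<integral>\<^sup>+t\<in>{0<..<1}. f t \<partial>lborel)"
proof -
  have "(\<Sum>m. \<integral>\<^sup>+t\<in>cell m. f t \<partial>lborel) = (\<integral>\<^sup>+t. f t * (\<Sum>m. indicator (cell m) t) \<partial>lborel)"
    by (simp add: nn_integral_suminf[symmetric])
  then show ?thesis
    by (simp add: suminf_indicator[OF disjoint_family_cell] UN_cell)
qed

section \<open>Concentration of each power on its own cell\<close>

text \<open>The left-hand side is \<open>exp (- x)\<close> for \<open>x = u n / s\<close>, with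
  \<open>s\<close> the geometric mean at the cut. Then \<open>exp (- x) \<le> 1 / x\<close>, and
  \<open>x\<close> is at least \<open>sqrt r ^ (2 * k + 1)\<close>, where
  \<open>2 * k + 1 = 2 * (n - m) - 1\<close>.\<close>

lemma cut_powr_below:
  assumes "m < n"
  shows "cut (Suc m) powr u n \<le> wt d m n powr p"
proof -
  obtain k where n: "n = m + Suc k"
    using assms less_imp_Suc_add by auto
  define s where "s = sqrt (u m * u (Suc m))"
  have s: "0 < s"
    using u_pos by (simp add: s_def)
  have "exp (- (u n / s)) \<le> s / u n"
    using exp_ge_add_one_self[of "u n / s"] s u_pos[of n] by (simp add: exp_minus field_simps)
  also have "\<dots> \<le> 1 / sqrt r ^ (2 * k + 1)"
    using sqrt_u_le[of m k] u_pos[of n] r by (simp add: n s_def field_simps)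
  also have "\<dots> = wt d m n powr p"
    by (simp add: offset_weight_def n q_power_powr flip: power_Suc)
  finally show ?thesis
    by (simp add: cut_def s_def powr_def)
qed

text \<open>Dual to the previous bound: \<open>1 - exp (- x) \<le> x\<close>, and now
  \<open>x = u n / s\<close> is small because the cut lies above index \<open>n\<close>.\<close>

lemma cut_powr_above:
  assumes "n < m"
  shows "1 - cut m powr u n \<le> wt d m n powr p"
proof -
  obtain k where m: "m = Suc (n + k)"
    using assms less_imp_Suc_add by auto
  define s where "s = sqrt (u (n + k) * u m)"
  have s: "0 < s"
    using u_pos by (simp add: s_def)
  have "1 - exp (- (u n / s)) \<le> u n / s"
    using exp_ge_add_one_self[of "- (u n / s)"] by simp
  also have "\<dots> \<le> 1 / sqrt r ^ (2 * k + 1)"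
    using sqrt_u_ge[of n k] s r by (simp add: m s_def field_simps)
  also have "\<dots> = wt d m n powr p"
    by (simp add: offset_weight_def m q_power_powr flip: power_Suc)
  finally show ?thesis
    by (simp add: cut_def s_def m powr_def)
qed

text \<open>The cell is enlarged to the tail \<open>{0..cut (Suc m)}\<close> or
  \<open>{cut m..1}\<close> on its side of the diagonal, and to the whole interval on the diagonal,
  where weight 1 gives the full integral \<open>1 / u n\<close>.\<close>

lemma nn_integral_cell_le:
  assumes "m \<noteq> n \<or> d = 1"
  shows "(\<integral>\<^sup>+t\<in>cell m. ennreal (t powr (p * \<Lambda> n)) \<partial>lborel) \<le> ennreal (wt d m n powr p / u n)"
proof -
  have e: "0 \<le> p * \<Lambda> n"
    using p \<Lambda>_nonneg by simp
  consider "m < n" | "n < m" | "m = n" "d = 1"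
    using assms by linarith
  then show ?thesis
  proof cases
    case 1
    have "(\<integral>\<^sup>+t\<in>cell m. ennreal (t powr (p * \<Lambda> n)) \<partial>lborel) \<le> (\<integral>\<^sup>+t\<in>{0..cut (Suc m)}. ennreal (t powr (p * \<Lambda> n)) \<partial>lborel)"
      using cut_bounds[of m] by (intro nn_integral_mono) (auto simp: indicator_def cell_def)
    also have "\<dots> = ennreal (cut (Suc m) powr u n / u n)"
      using e cut_bounds by (simp add: nn_integral_powr_from_0 u_def)
    also have "\<dots> \<le> ennreal (wt d m n powr p / u n)"
      using cut_powr_below[OF 1] u_pos[of n] by (intro ennreal_leI divide_right_mono) auto
    finally show ?thesis .
  next
    case 2
    have "(\<integral>\<^sup>+t\<in>cell m. ennreal (t powr (p * \<Lambda> n)) \<partial>lborel) \<le> (\<integral>\<^sup>+t\<in>{cut m..1}. ennreal (t powr (p * \<Lambda> n)) \<partial>lborel)"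
      using cut_bounds(2)[of "Suc m"] by (intro nn_integral_mono) (auto simp: indicator_def cell_def)
    also have "\<dots> = ennreal ((1 - cut m powr u n) / u n)"
      using e cut_bounds(1)[of m] less_imp_le[OF cut_bounds(2)[of m]] by (simp add: nn_integral_powr_to_1 u_def)
    also have "\<dots> \<le> ennreal (wt d m n powr p / u n)"
      using cut_powr_above[OF 2] u_pos[of n] by (intro ennreal_leI divide_right_mono) auto
    finally show ?thesis .
  next
    case 3
    have "(\<integral>\<^sup>+t\<in>cell m. ennreal (t powr (p * \<Lambda> n)) \<partial>lborel) \<le> (\<integral>\<^sup>+t\<in>{0..1}. ennreal (t powr (p * \<Lambda> n)) \<partial>lborel)"
      using cell_subset[of m] by (intro nn_integral_mono) (auto simp: indicator_def)
    then show ?thesis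
      using e 3 by (simp add: nn_integral_powr_from_0 u_def offset_weight_def)
  qed
qed

text \<open>Each tail outside the cell carries at most a fraction \<open>1 / sqrt r\<close> of the
  total \<open>1 / u n\<close>, by the bounds at distance 1. For \<open>n = 0\<close> the left tail
  is trivial.\<close>

lemma nn_integral_cell_diagonal_ge:
  "ennreal (1 / u n) \<le> (\<integral>\<^sup>+t\<in>cell n. ennreal (t powr (p * \<Lambda> n)) \<partial>lborel) + ennreal (2 / sqrt r / u n)"
proof -
  have e: "0 \<le> p * \<Lambda> n"
    using p \<Lambda>_nonneg by simp
  have "cut n powr u n / u n \<le> 1 / sqrt r / u n"
  proof (intro divide_right_mono)
    show "cut n powr u n \<le> 1 / sqrt r"
    proof (cases n)
      \<comment> \<open>Off-diagonal weights do not depend on \<open>d\<close>, so its value 0 here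
        is arbitrary.\<close>
      case (Suc m)
      then show ?thesis
        using cut_powr_below[of m n 0] q_power_powr[of 1] by (simp add: offset_weight_def)
    qed (use r in \<open>simp add: cut_def\<close>)
  qed (use u_pos less_imp_le in auto)
  moreover have "(1 - cut (Suc n) powr u n) / u n \<le> 1 / sqrt r / u n"
    using cut_powr_above[of n "Suc n" 0] u_pos[of n] q_power_powr[of 1]
    by (intro divide_right_mono) (auto simp: offset_weight_def)
  ultimately have "ennreal (cut n powr u n / u n) + ennreal ((1 - cut (Suc n) powr u n) / u n)
      \<le> ennreal (1 / sqrt r / u n) + ennreal (1 / sqrt r / u n)"
    by (intro add_mono ennreal_leI)
  also have "\<dots> = ennreal (2 / sqrt r / u n)"
    using r u_pos[of n] by (simp flip: ennreal_plus add: field_simps)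
  finally show ?thesis
    using nn_integral_powr_from_to[OF e cut_bounds(1)[of n] monoD[OF mono_cut, of n "Suc n"] less_imp_le[OF cut_bounds(2)]]
    by (simp add: cell_def u_def) (meson add_left_mono order_trans)
qed

section \<open>Comparison of the energy of \<open>J\<close> with the coefficients\<close>

text \<open>Equally the \<open>p\<close>-th power of the \<open>Lp_norm\<close> of the single term
  with index \<open>n\<close>.\<close>

definition mass :: "(nat \<Rightarrow> complex) \<Rightarrow> nat \<Rightarrow> real" where
  "mass a n = norm (a n) powr p * muntz_weight p \<Lambda> n"

text \<open>The \<open>p\<close>-th power of the norm, kept in \<open>ennreal\<close> so that it is
  meaningful before finiteness is known.\<close>

definition energy :: "(real \<Rightarrow> complex) \<Rightarrow> ennreal" where
  "energy f = (\<integral>\<^sup>+t\<in>{0<..<1}. ennreal (norm (f t) powr p) \<partial>lborel)"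

lemma mass_nonneg: "0 \<le> mass a n"
  using u_pos[of n] by (simp add: mass_def muntz_weight_def u_def)

lemma mass_eq: "mass a n = norm (a n) powr p / u n"
  by (simp add: mass_def muntz_weight_def u_def field_simps)

lemma J_measurable [measurable]: "J \<Lambda> a \<in> borel_measurable borel"
  by (simp add: J_def[abs_def])

text \<open>For fixed \<open>t\<close> the product \<open>u n * t powr \<Lambda> n\<close> is
  bounded, and \<open>norm (a n)\<close> is at most \<open>u n\<close> times the summable quantity
  \<open>(1 / r) ^ n + mass a n\<close>.\<close>

lemma summable_norm_J:
  assumes a: "a \<in> weighted_lp p (muntz_weight p \<Lambda>)" and t: "t \<in> {0<..<1}"
  shows "summable (\<lambda>n. norm (a n * monomial (\<Lambda> n) t))"
proof (rule summable_comparison_test')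
  define s where "s = - ln t"
  have s: "0 < s"
    using t by (simp add: s_def)
  define K where "K = p / s + 1"
  have ut: "u n * t powr \<Lambda> n \<le> K" for n
  proof -
    \<comment> \<open>This is \<open>x * exp (- x) \<le> 1\<close>; it yields the summand
      \<open>p / s\<close> of \<open>K\<close>, while the summand 1 comes from
      \<open>t powr \<Lambda> n \<le> 1\<close>.\<close>
    have "\<Lambda> n * s * exp (- (\<Lambda> n * s)) \<le> 1"
      using exp_ge_add_one_self[of "\<Lambda> n * s"]
      by (simp add: exp_minus divide_inverse[symmetric] del: exp_ge_add_one_self)
    then have "\<Lambda> n * t powr \<Lambda> n \<le> 1 / s"
      using s t by (simp add: powr_def s_def field_simps)
    then have "p * (\<Lambda> n * t powr \<Lambda> n) \<le> p * (1 / s)"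
      using p by (intro mult_left_mono) auto
    moreover have "t powr \<Lambda> n \<le> 1"
      using t \<Lambda>_nonneg[of n] by (simp add: powr_le1)
    ultimately show ?thesis
      by (simp add: u_def K_def algebra_simps)
  qed
  have K: "0 < K"
    using s p by (simp add: K_def add_pos_pos)
  show "summable (\<lambda>n. K * ((1 / r) ^ n + mass a n))"
    using a r by (intro summable_mult summable_add summable_geometric) (auto simp: weighted_lp_def mass_def)
  show "norm (norm (a n * monomial (\<Lambda> n) t)) \<le> K * ((1 / r) ^ n + mass a n)" for n
  proof -
    have "norm (a n) \<le> 1 + norm (a n) powr p"
      using p powr_mono[of 1 p "norm (a n)"] by (cases "norm (a n) \<le> 1") (auto intro: add_increasing2)
    also have "\<dots> = (1 / u n + mass a n) * u n"
      using u_pos[of n] by (simp add: mass_eq field_simps)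
    also have "\<dots> \<le> ((1 / r) ^ n + mass a n) * u n"
    proof -
      have "r ^ n * 1 \<le> r ^ n * u 0"
        using r u_ge_1[of 0] by (intro mult_left_mono) auto
      also have "\<dots> \<le> u n"
        using u_growth[of n 0] by simp
      finally have "1 / u n \<le> (1 / r) ^ n"
        using r by (simp add: power_divide frac_le)
      then show ?thesis
        using u_pos[of n] by (intro mult_right_mono add_mono) auto
    qed
    finally have "norm (a n) * t powr \<Lambda> n \<le> ((1 / r) ^ n + mass a n) * u n * t powr \<Lambda> n"
      by (intro mult_right_mono) auto
    also have "\<dots> \<le> ((1 / r) ^ n + mass a n) * K"
      unfolding mult.assoc using ut r mass_nonneg by (intro mult_left_mono) auto
    finally show ?thesis
      using t by (simp add: norm_mult norm_monomial mult_ac)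
  qed
qed

lemma nn_integral_cell_term_le:
  assumes "m \<noteq> n \<or> d = 1"
  shows "(\<integral>\<^sup>+t\<in>cell m. ennreal (norm (a n * monomial (\<Lambda> n) t) powr p) \<partial>lborel)
    \<le> ennreal (wt d m n powr p) * ennreal (mass a n)"
proof -
  have "(\<integral>\<^sup>+t\<in>cell m. ennreal (norm (a n * monomial (\<Lambda> n) t) powr p) \<partial>lborel) =
      (\<integral>\<^sup>+t. ennreal (norm (a n) powr p) * (ennreal (t powr (p * \<Lambda> n)) * indicator (cell m) t) \<partial>lborel)"
    using cell_subset[of m]
    by (intro nn_integral_cong) (auto simp: norm_monomial_powr indicator_def ennreal_mult)
  also have "\<dots> = ennreal (norm (a n) powr p) * (\<integral>\<^sup>+t\<in>cell m. ennreal (t powr (p * \<Lambda> n)) \<partial>lborel)"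
    by (intro nn_integral_cmult) measurable
  also have "\<dots> \<le> ennreal (norm (a n) powr p) * ennreal (wt d m n powr p / u n)"
    using nn_integral_cell_le[OF assms] by (intro mult_left_mono) auto
  also have "\<dots> = ennreal (wt d m n powr p) * ennreal (mass a n)"
    using u_pos[of n] by (simp add: mass_eq mult_ac flip: ennreal_mult)
  finally show ?thesis .
qed

text \<open>Diagonal weight \<open>d = 1\<close> treats the full series, \<open>d = 0\<close> its off-diagonal part.\<close>

lemma suminf_cell_le:
  assumes a: "a \<in> weighted_lp p (muntz_weight p \<Lambda>)" and d: "d = 0 \<or> d = 1"
  defines "g \<equiv> \<lambda>m t. J \<Lambda> a t - (if d = 0 then a m * monomial (\<Lambda> m) t else 0)"
  shows "(\<Sum>m. \<integral>\<^sup>+t\<in>cell m. ennreal (norm (g m t) powr p) \<partial>lborel)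
    \<le> ennreal ((d + C) powr p) * (\<Sum>n. ennreal (mass a n))"
proof (rule block_powr_le)
  show "1 \<le> p" by (rule p)
  show W: "0 < d + C"
    using C_pos d by auto
  show "(\<lambda>t. a n * monomial (\<Lambda> n) t) \<in> borel_measurable lborel" for n
    by measurable
  show "cell m \<in> sets lborel" for m
    by simp
  show w: "0 \<le> wt d m n" for m n
    using q_bounds d by (auto simp: offset_weight_def)
  show col: "(\<Sum>m. ennreal (wt d m n)) \<le> ennreal (d + C)" for n
    using q_bounds d unfolding offdiag_bound_def by (intro suminf_offset_weight_le) auto
  show "(\<integral>\<^sup>+t\<in>cell m. ennreal (norm (a n * monomial (\<Lambda> n) t) powr p) \<partial>lborel)
      \<le> ennreal (wt d m n powr p) * ennreal (mass a n)" if "wt d m n \<noteq> 0" for m n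
    by (rule nn_integral_cell_term_le) (use that d in \<open>auto simp: offset_weight_def split: if_splits\<close>)
  show "ennreal (norm (g m t) powr p) \<le> ennreal ((d + C) powr (p - 1)) *
      (\<Sum>n. ennreal (wt d m n powr (1 - p)) * ennreal (norm (a n * monomial (\<Lambda> n) t) powr p))"
    if "t \<in> cell m" for m t
  proof -
    \<comment> \<open>The weighted inequality demands that terms of weight 0 vanish. Only the
      diagonal term for \<open>d = 0\<close> is affected, and \<open>g\<close> subtracts exactly
      that one.\<close>
    define x where "x n = (if wt d m n = 0 then 0 else a n * monomial (\<Lambda> n) t)" for n
    have sum: "summable (\<lambda>n. norm (a n * monomial (\<Lambda> n) t))"
      using summable_norm_J[OF a] cell_subset that by blast
    have wt0: "wt d m n = 0 \<longleftrightarrow> n = m \<and> d = 0" for n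
      using q_bounds by (auto simp: offset_weight_def)
    have "(\<lambda>n. a n * monomial (\<Lambda> n) t - (if n = m then (if d = 0 then a m * monomial (\<Lambda> m) t else 0) else 0)) sums g m t"
      unfolding g_def J_def by (intro sums_diff sums_single summable_sums summable_norm_cancel[OF sum])
    moreover have "(\<lambda>n. a n * monomial (\<Lambda> n) t - (if n = m then (if d = 0 then a m * monomial (\<Lambda> m) t else 0) else 0)) = x"
      by (auto simp: x_def wt0 fun_eq_iff)
    ultimately have g: "g m t = (\<Sum>n. x n)"
      by (simp add: sums_iff)
    have "ennreal (norm (g m t) powr p) \<le> ennreal ((d + C) powr (p - 1)) *
        (\<Sum>n. ennreal (wt d m n powr (1 - p)) * ennreal (norm (x n) powr p))"
      unfolding g
    proof (rule powr_norm_suminf_le_weighted)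
      show "summable (\<lambda>n. norm (x n))"
        by (rule summable_comparison_test'[OF sum]) (auto simp: x_def)
      \<comment> \<open>The kernel is symmetric, so the column bound is also the row bound.\<close>
      show "(\<Sum>n. ennreal (wt d m n)) \<le> ennreal (d + C)"
        using col[of m] by (simp only: offset_weight_commute[of d q m])
    qed (use p w W in \<open>auto simp: x_def\<close>)
    also have "\<dots> \<le> ennreal ((d + C) powr (p - 1)) *
        (\<Sum>n. ennreal (wt d m n powr (1 - p)) * ennreal (norm (a n * monomial (\<Lambda> n) t) powr p))"
      by (intro mult_left_mono suminf_le summableI) (auto simp: x_def)
    finally show ?thesis .
  qed
qed

lemma suminf_mass:
  assumes "a \<in> weighted_lp p (muntz_weight p \<Lambda>)"
  shows "(\<Sum>n. ennreal (mass a n)) = ennreal (\<Sum>n. mass a n)"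
  using assms by (intro suminf_ennreal2 mass_nonneg) (simp add: weighted_lp_def mass_def)

lemma energy_J_le:
  assumes a: "a \<in> weighted_lp p (muntz_weight p \<Lambda>)"
  shows "energy (J \<Lambda> a) \<le> ennreal ((1 + C) powr p * (\<Sum>n. mass a n))"
proof -
  have "energy (J \<Lambda> a) = (\<Sum>m. \<integral>\<^sup>+t\<in>cell m. ennreal (norm (J \<Lambda> a t) powr p) \<partial>lborel)"
    unfolding energy_def by (rule suminf_nn_integral_cell[symmetric]) measurable
  also have "\<dots> \<le> ennreal ((1 + C) powr p) * (\<Sum>n. ennreal (mass a n))"
    using suminf_cell_le[OF a, of 1] by simp
  finally show ?thesis
    by (simp add: suminf_mass[OF a] ennreal_mult')
qed

text \<open>On \<open>cell m\<close> the term with index \<open>m\<close> is \<open>J\<close> minus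
  an off-diagonal remainder, and the cell holds all but a fraction \<open>2 / sqrt r\<close> of that
  term's mass. Both losses stay on the right until all quantities are known to be finite.\<close>

lemma energy_J_ge:
  assumes a: "a \<in> weighted_lp p (muntz_weight p \<Lambda>)"
  shows "ennreal (\<Sum>n. mass a n) \<le> ennreal ((1 + C) powr (p - 1)) * (energy (J \<Lambda> a) + ennreal (C * (\<Sum>n. mass a n)))
    + ennreal (2 / sqrt r * (\<Sum>n. mass a n))"
proof -
  define x where "x m t = a m * monomial (\<Lambda> m) t" for m t
  define c where "c = ennreal ((1 + C) powr (p - 1))"
  define F where "F m = (\<integral>\<^sup>+t\<in>cell m. ennreal (norm (J \<Lambda> a t) powr p) \<partial>lborel)" for m
  define E where "E m = (\<integral>\<^sup>+t\<in>cell m. ennreal (norm (J \<Lambda> a t - x m t) powr p) \<partial>lborel)" for m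
  have [measurable]: "x m \<in> borel_measurable borel" for m
    unfolding x_def by measurable
  have S: "0 \<le> (\<Sum>n. mass a n)"
    using a by (intro suminf_nonneg mass_nonneg) (simp add: weighted_lp_def mass_def)
  \<comment> \<open>Two-term Jensen with weight 1 for \<open>J\<close> and weight \<open>C\<close>
    for the remainder. The remainder has total energy at most \<open>C powr p\<close> times the
    mass, so the factor \<open>C powr (1 - p)\<close> leaves a loss linear in
    \<open>C\<close>.\<close>
  have pt: "norm (x m t) powr p \<le> (1 + C) powr (p - 1) *
      (norm (J \<Lambda> a t) powr p + C powr (1 - p) * norm (J \<Lambda> a t - x m t) powr p)" for m t
  proof -
    have "norm (x m t) powr p \<le> (norm (J \<Lambda> a t - x m t) + norm (J \<Lambda> a t)) powr p"
      using p norm_triangle_ineq4[of "J \<Lambda> a t" "J \<Lambda> a t - x m t"] by (intro powr_mono2) auto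
    also have "\<dots> \<le> (1 + C) powr (p - 1) *
      (norm (J \<Lambda> a t) powr p + C powr (1 - p) * norm (J \<Lambda> a t - x m t) powr p)"
      using powr_sum_le_weighted[of p UNIV "\<lambda>b. if b then 1 else C"
          "\<lambda>b. if b then norm (J \<Lambda> a t) else norm (J \<Lambda> a t - x m t)" "1 + C"] p C_pos
      by (simp add: UNIV_bool add.commute split: if_splits)
    finally show ?thesis .
  qed
  have "ennreal (mass a m) \<le> c * (F m + ennreal (C powr (1 - p)) * E m) + ennreal (2 / sqrt r) * ennreal (mass a m)" for m
  proof -
    have "ennreal (norm (a m) powr p) * ennreal (1 / u m) \<le>
        ennreal (norm (a m) powr p) * ((\<integral>\<^sup>+t\<in>cell m. ennreal (t powr (p * \<Lambda> m)) \<partial>lborel) + ennreal (2 / sqrt r / u m))"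
      by (intro mult_left_mono nn_integral_cell_diagonal_ge) auto
    also have "\<dots> = (\<integral>\<^sup>+t. ennreal (norm (a m) powr p) * (ennreal (t powr (p * \<Lambda> m)) * indicator (cell m) t) \<partial>lborel) +
        ennreal (norm (a m) powr p) * ennreal (2 / sqrt r / u m)"
      by (simp add: distrib_left nn_integral_cmult)
    also have "(\<integral>\<^sup>+t. ennreal (norm (a m) powr p) * (ennreal (t powr (p * \<Lambda> m)) * indicator (cell m) t) \<partial>lborel)
        = (\<integral>\<^sup>+t\<in>cell m. ennreal (norm (x m t) powr p) \<partial>lborel)"
      using cell_subset[of m] unfolding x_def
      by (intro nn_integral_cong) (auto simp: norm_monomial_powr indicator_def ennreal_mult)
    also have "(\<integral>\<^sup>+t\<in>cell m. ennreal (norm (x m t) powr p) \<partial>lborel) \<le>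
        (\<integral>\<^sup>+t. c * (ennreal (norm (J \<Lambda> a t) powr p) * indicator (cell m) t +
          ennreal (C powr (1 - p)) * (ennreal (norm (J \<Lambda> a t - x m t) powr p) * indicator (cell m) t)) \<partial>lborel)"
      using ennreal_leI[OF pt[of m]]
      by (intro nn_integral_mono) (auto simp: indicator_def c_def ennreal_mult' ennreal_plus)
    also have "\<dots> = c * (F m + ennreal (C powr (1 - p)) * E m)"
      unfolding F_def E_def by (simp add: nn_integral_cmult nn_integral_add)
    also have "ennreal (norm (a m) powr p) * ennreal (2 / sqrt r / u m) = ennreal (2 / sqrt r) * ennreal (mass a m)"
      using u_pos[of m] r by (simp add: mass_eq mult_ac flip: ennreal_mult)
    finally show ?thesis
      using u_pos[of m] by (simp add: mass_eq flip: ennreal_mult)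
  qed
  then have "(\<Sum>m. ennreal (mass a m)) \<le>
      (\<Sum>m. c * (F m + ennreal (C powr (1 - p)) * E m) + ennreal (2 / sqrt r) * ennreal (mass a m))"
    by (intro suminf_le summableI)
  also have "\<dots> = c * ((\<Sum>m. F m) + ennreal (C powr (1 - p)) * (\<Sum>m. E m)) + ennreal (2 / sqrt r) * (\<Sum>m. ennreal (mass a m))"
    by (simp add: suminf_add[symmetric])
  also have "(\<Sum>m. F m) = energy (J \<Lambda> a)"
    unfolding energy_def F_def by (rule suminf_nn_integral_cell) measurable
  also have "c * (energy (J \<Lambda> a) + ennreal (C powr (1 - p)) * (\<Sum>m. E m)) + ennreal (2 / sqrt r) * (\<Sum>m. ennreal (mass a m)) \<le>
      c * (energy (J \<Lambda> a) + ennreal (C powr (1 - p)) * (ennreal (C powr p) * (\<Sum>n. ennreal (mass a n)))) +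
      ennreal (2 / sqrt r) * (\<Sum>m. ennreal (mass a m))"
    using suminf_cell_le[OF a, of 0] unfolding E_def x_def
    by (intro add_right_mono mult_left_mono add_left_mono) auto
  also have "ennreal (C powr (1 - p)) * (ennreal (C powr p) * (\<Sum>n. ennreal (mass a n))) = ennreal (C * (\<Sum>n. mass a n))"
    using C_pos S by (simp add: suminf_mass[OF a] ennreal_mult[symmetric] mult.assoc[symmetric] powr_add[symmetric])
  also have "ennreal (2 / sqrt r) * (\<Sum>m. ennreal (mass a m)) = ennreal (2 / sqrt r * (\<Sum>n. mass a n))"
    using r S unfolding suminf_mass[OF a] by (intro ennreal_mult[symmetric]) auto
  finally show ?thesis
    by (simp only: suminf_mass[OF a] c_def)
qed

section \<open>Norm estimates and convergence of the series\<close>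

lemma Lp_norm_eq_energy:
  assumes "f \<in> borel_measurable borel"
  shows "Lp_norm p f = enn2real (energy f) powr (1 / p)"
  unfolding energy_def by (rule Lp_norm_eq_nn_integral[OF assms])

lemma weighted_lp_norm_eq: "weighted_lp_norm p (muntz_weight p \<Lambda>) a = (\<Sum>n. mass a n) powr (1 / p)"
  by (simp add: weighted_lp_norm_def mass_def)

lemma suminf_mass_nonneg:
  assumes "a \<in> weighted_lp p (muntz_weight p \<Lambda>)"
  shows "0 \<le> (\<Sum>n. mass a n)"
  using assms by (intro suminf_nonneg mass_nonneg) (simp add: weighted_lp_def mass_def)

lemma enn2real_energy_J_le:
  assumes a: "a \<in> weighted_lp p (muntz_weight p \<Lambda>)"
  shows "enn2real (energy (J \<Lambda> a)) \<le> (1 + C) powr p * (\<Sum>n. mass a n)"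
  using energy_J_le[OF a] suminf_mass_nonneg[OF a] by (intro enn2real_leI) auto

lemma J_upper:
  assumes a: "a \<in> weighted_lp p (muntz_weight p \<Lambda>)"
  shows "Lp_norm p (J \<Lambda> a) \<le> (1 + C) * weighted_lp_norm p (muntz_weight p \<Lambda>) a"
proof -
  have "Lp_norm p (J \<Lambda> a) \<le> ((1 + C) powr p * (\<Sum>n. mass a n)) powr (1 / p)"
    unfolding Lp_norm_eq_energy[OF J_measurable] using p enn2real_energy_J_le[OF a]
    by (intro powr_mono2) auto
  then show ?thesis
    using p C_pos suminf_mass_nonneg[OF a] by (simp add: weighted_lp_norm_eq powr_mult powr_powr)
qed

lemma J_lower:
  assumes a: "a \<in> weighted_lp p (muntz_weight p \<Lambda>)" and e: "0 \<le> e"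
    "e powr p \<le> (1 - 2 / sqrt r) * (1 + C) powr (1 - p) - C"
  shows "e * weighted_lp_norm p (muntz_weight p \<Lambda>) a \<le> Lp_norm p (J \<Lambda> a)"
proof -
  define I where "I = enn2real (energy (J \<Lambda> a))"
  define S where "S = (\<Sum>n. mass a n)"
  have S: "0 \<le> S"
    unfolding S_def by (rule suminf_mass_nonneg[OF a])
  \<comment> \<open>Finiteness, taken from the upper bound, moves the inequality to the reals, where
    it can be solved for \<open>I\<close>.\<close>
  have "energy (J \<Lambda> a) < top"
    using energy_J_le[OF a] by (rule le_less_trans) simp
  then have I: "energy (J \<Lambda> a) = ennreal I"
    by (simp add: I_def)
  have I0: "0 \<le> I"
    by (simp add: I_def)
  define c where "c = (1 + C) powr (p - 1)"
  have c: "0 < c"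
    using C_pos by (simp add: c_def)
  have "ennreal S \<le> ennreal (c * (I + C * S) + 2 / sqrt r * S)"
    using energy_J_ge[OF a] I0 S C_pos r c
    by (simp add: I S_def[symmetric] c_def[symmetric] flip: ennreal_plus ennreal_mult)
  then have "S \<le> c * (I + C * S) + 2 / sqrt r * S"
    using I0 S C_pos r c by (subst (asm) ennreal_le_iff) auto
  then have "((1 - 2 / sqrt r) / c - C) * S \<le> I"
    using c by (simp add: field_simps)
  moreover have "(1 - 2 / sqrt r) * (1 + C) powr (1 - p) = (1 - 2 / sqrt r) / c"
    using C_pos by (simp add: c_def powr_diff)
  ultimately have "e powr p * S \<le> I"
    using e(2) S mult_right_mono[OF e(2) S] by simp
  then have "(e powr p * S) powr (1 / p) \<le> I powr (1 / p)"
    using p S by (intro powr_mono2) auto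
  then show ?thesis
    using p e(1) S
    by (simp add: weighted_lp_norm_eq S_def[symmetric] powr_mult powr_powr Lp_norm_eq_energy[OF J_measurable] I_def)
qed

text \<open>The error of a partial sum is \<open>J\<close> of the tail \<open>b N\<close> of the
  coefficients. The upper estimate bounds its norm through the tail of a convergent series.\<close>

lemma J_well_defined:
  assumes a: "a \<in> weighted_lp p (muntz_weight p \<Lambda>)"
  shows "J_well_defined p \<Lambda> a"
proof -
  define P where "P N t = (\<Sum>n<N. a n * monomial (\<Lambda> n) t)" for N t
  define b where "b N n = (if n < N then 0 else a n)" for N n
  have [measurable]: "P N \<in> borel_measurable borel" for N
    unfolding P_def by measurable
  have Bb: "mass (b N) n = mass a n - (if n < N then mass a n else 0)" for N n
    by (simp add: b_def mass_def)
  have sumB: "(\<lambda>n. mass a n) sums (\<Sum>n. mass a n)"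
    using a by (intro summable_sums) (simp add: weighted_lp_def mass_def)
  have Bb_sums: "mass (b N) sums ((\<Sum>n. mass a n) - (\<Sum>n<N. mass a n))" for N
    unfolding Bb using sums_If_finite_set[of "{..<N}" "mass a"] by (intro sums_diff sumB) simp
  have b: "b N \<in> weighted_lp p (muntz_weight p \<Lambda>)" for N
    using sums_summable[OF Bb_sums[of N]] by (simp add: weighted_lp_def mass_def[abs_def])
  \<comment> \<open>The open interval suffices because \<open>energy\<close> ignores the end points;
    at 1 the series may diverge.\<close>
  have "J \<Lambda> a t - P N t = J \<Lambda> (b N) t" if "t \<in> {0<..<1}" for N t
  proof -
    have "(\<lambda>n. a n * monomial (\<Lambda> n) t - (if n \<in> {..<N} then a n * monomial (\<Lambda> n) t else 0)) sums (J \<Lambda> a t - P N t)"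
      unfolding P_def J_def
      by (intro sums_diff sums_If_finite_set summable_sums summable_norm_cancel[OF summable_norm_J[OF a that]]) simp
    moreover have "(\<lambda>n. a n * monomial (\<Lambda> n) t - (if n \<in> {..<N} then a n * monomial (\<Lambda> n) t else 0)) =
        (\<lambda>n. b N n * monomial (\<Lambda> n) t)"
      by (auto simp: b_def)
    ultimately show ?thesis
      by (simp add: J_def sums_iff)
  qed
  then have "energy (\<lambda>t. J \<Lambda> a t - P N t) = energy (J \<Lambda> (b N))" for N
    unfolding energy_def by (intro nn_integral_cong) (auto simp: indicator_def)
  then have "Lp_norm p (\<lambda>t. J \<Lambda> a t - P N t) = Lp_norm p (J \<Lambda> (b N))" for N
    by (simp add: Lp_norm_eq_energy)
  then have le: "Lp_norm p (\<lambda>t. J \<Lambda> a t - P N t) \<le> (1 + C) * ((\<Sum>n. mass a n) - (\<Sum>n<N. mass a n)) powr (1 / p)" for N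
    using J_upper[OF b[of N]] sums_unique[OF Bb_sums[of N]] by (simp add: weighted_lp_norm_eq)
  have lim: "(\<lambda>N. Lp_norm p (\<lambda>t. J \<Lambda> a t - P N t)) \<longlonglongrightarrow> 0"
  proof (rule tendsto_sandwich[where f = "\<lambda>_. 0"])
    have "(\<lambda>N. (\<Sum>n. mass a n) - (\<Sum>n<N. mass a n)) \<longlonglongrightarrow> (\<Sum>n. mass a n) - (\<Sum>n. mass a n)"
      using sumB unfolding sums_def by (intro tendsto_diff tendsto_const)
    then have "(\<lambda>N. ((\<Sum>n. mass a n) - (\<Sum>n<N. mass a n)) powr (1 / p)) \<longlonglongrightarrow> 0 powr (1 / p)"
      using p mass_nonneg sum_le_suminf[OF sums_summable[OF sumB]]
      by (intro tendsto_powr'[OF _ tendsto_const]) auto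
    then show "(\<lambda>N. (1 + C) * ((\<Sum>n. mass a n) - (\<Sum>n<N. mass a n)) powr (1 / p)) \<longlonglongrightarrow> 0"
      using tendsto_mult_right_zero by simp
  qed (use le in \<open>auto simp: Lp_norm_def intro!: always_eventually\<close>)
  have "J \<Lambda> a \<in> Lp_space p"
    using energy_J_le[OF a] unfolding energy_def
    by (intro Lp_space_if_nn_integral_finite) (auto intro: le_less_trans)
  moreover have "\<exists>g\<in>muntz_polynomials \<Lambda>. Lp_norm p (\<lambda>t. J \<Lambda> a t - g t) < e" if e: "0 < e" for e
  proof -
    obtain N where "Lp_norm p (\<lambda>t. J \<Lambda> a t - P N t) < e"
      using eventually_happens[OF order_tendstoD(2)[OF lim e]] by auto
    moreover have "P N \<in> muntz_polynomials \<Lambda>"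
      unfolding muntz_polynomials_def P_def by blast
    ultimately show ?thesis
      by blast
  qed
  ultimately show ?thesis
    using lim by (simp add: J_well_defined_def muntz_space_def P_def)
qed

end

theorem theorem3p6:
  fixes p :: real
  assumes "1 < p"
  shows "\<forall>\<epsilon>\<in>{0<..<1}. \<exists>r>1. \<forall>\<Lambda>. muntz_sequence \<Lambda> \<and> lacunary r (\<lambda>n. p * \<Lambda> n + 1) \<longrightarrow>
    (\<forall>a\<in>weighted_lp p (muntz_weight p \<Lambda>).
       J_well_defined p \<Lambda> a \<and>
       (1 - \<epsilon>) * weighted_lp_norm p (muntz_weight p \<Lambda>) a \<le> Lp_norm p (J \<Lambda> a) \<and>
       Lp_norm p (J \<Lambda> a) \<le> (1 + \<epsilon>) * weighted_lp_norm p (muntz_weight p \<Lambda>) a)"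
proof
  fix \<epsilon> :: real
  assume \<epsilon>: "\<epsilon> \<in> {0<..<1}"
  \<comment> \<open>The ratio depends only on \<open>p\<close> and \<epsilon>, and is fixed before
    \<Lambda> and the coefficients are introduced.\<close>
  obtain r where lac: "1 < r" "offdiag_bound p r \<le> \<epsilon>"
    "(1 - \<epsilon>) powr p \<le> (1 - 2 / sqrt r) * (1 + offdiag_bound p r) powr (1 - p) - offdiag_bound p r"
    using ex_lacunarity_constant[of p \<epsilon>] assms \<epsilon> by auto
  show "\<exists>r>1. \<forall>\<Lambda>. muntz_sequence \<Lambda> \<and> lacunary r (\<lambda>n. p * \<Lambda> n + 1) \<longrightarrow>
    (\<forall>a\<in>weighted_lp p (muntz_weight p \<Lambda>).
       J_well_defined p \<Lambda> a \<and>
       (1 - \<epsilon>) * weighted_lp_norm p (muntz_weight p \<Lambda>) a \<le> Lp_norm p (J \<Lambda> a) \<and>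
       Lp_norm p (J \<Lambda> a) \<le> (1 + \<epsilon>) * weighted_lp_norm p (muntz_weight p \<Lambda>) a)"
  proof (intro exI[of _ r] conjI allI impI ballI)
    fix \<Lambda> a
    assume \<Lambda>: "muntz_sequence \<Lambda> \<and> lacunary r (\<lambda>n. p * \<Lambda> n + 1)"
      and a: "a \<in> weighted_lp p (muntz_weight p \<Lambda>)"
    interpret lacunary_exponents p r \<Lambda>
      using \<Lambda> assms lac(1) by unfold_locales (auto simp: muntz_sequence_def lacunary_def)
    show "J_well_defined p \<Lambda> a"
      by (rule J_well_defined[OF a])
    show "(1 - \<epsilon>) * weighted_lp_norm p (muntz_weight p \<Lambda>) a \<le> Lp_norm p (J \<Lambda> a)"
      by (rule J_lower[OF a _ lac(3)]) (use \<epsilon> in auto)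
    have "Lp_norm p (J \<Lambda> a) \<le> (1 + offdiag_bound p r) * weighted_lp_norm p (muntz_weight p \<Lambda>) a"
      by (rule J_upper[OF a])
    also have "\<dots> \<le> (1 + \<epsilon>) * weighted_lp_norm p (muntz_weight p \<Lambda>) a"
      using lac by (intro mult_right_mono) (auto simp: weighted_lp_norm_def)
    finally show "Lp_norm p (J \<Lambda> a) \<le> (1 + \<epsilon>) * weighted_lp_norm p (muntz_weight p \<Lambda>) a" .
  qed (rule lac(1))
qed

end
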